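(* For all integers $n\ge 0$, the Padovan hyperbolic spinors $\psi_n$ and the Perrin hyperbolic spinors $\phi_n$ are given by $$\psi_n=A\sigma_1\alpha^n+B\sigma_2\beta^n+C\sigma_3\gamma^n,\qquad \phi_n=A\alpha^n+B\beta^n+C\gamma^n,$$ where $$A=\begin{bmatrix}1+\alpha^3 j\\ \alpha(-1+\alpha j)\end{bmatrix},\quad B=\begin{bmatrix}1+\beta^3 j\\ \beta(-1+\beta j)\end{bmatrix},\quad C=\begin{bmatrix}1+\gamma^3 j\\ \gamma(-1+\gamma j)\end{bmatrix}.$$
   Context: Hyperbolic numbers are expressions $a+bj$ with $a,b\in\mathbb{R}$ and a unit $j\notin\mathbb{R}$, $j^2=1$; they form a commutative ring. A hyperbolic spinor is a column vector with two hyperbolic number components. Since complex coefficients occur in the formulas, the identities are read for column vectors over the commutative ring $\{a+bj: a,b\in\mathbb{C}\}$, $j^2=1$, $j$ commuting with $\mathbb{C}$. The Padovan numbers $(P_n)_{n\ge 0}$ are defined by $P_0=P_1=P_2=1$ and $P_{n+3}=P_{n+1}+P_n$ for $n\ge0$. The Perrin numbers $(R_n)_{n\ge 0}$ are defined by $R_0=3$, $R_1=0$, $R_2=2$ and $R_{n+3}=R_{n+1}+R_n$ for $n\ge 0$. The $n$-th Padovan hyperbolic spinor and the $n$-th Perrin hyperbolic spinor are $$\psi_n=\begin{bmatrix}P_n+P_{n+3}j\\ -P_{n+1}+P_{n+2}j\end{bmatrix},\qquad \phi_n=\begin{bmatrix}R_n+R_{n+3}j\\ -R_{n+1}+R_{n+2}j\end{bmatrix}.$$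 $\alpha,\beta,\gamma$ are the three (distinct) complex roots of $x^3-x-1=0$, with $\alpha$ the real one and $\beta,\gamma$ the complex conjugate pair ($\beta$ having positive imaginary part), and $$\sigma_1=\frac{(\beta-1)(\gamma-1)}{(\alpha-\beta)(\alpha-\gamma)},\quad \sigma_2=\frac{(\alpha-1)(\gamma-1)}{(\beta-\alpha)(\beta-\gamma)},\quad \sigma_3=\frac{(\alpha-1)(\beta-1)}{(\gamma-\alpha)(\gamma-\beta)}.$$ *)

theory Defs
  imports "HOL-Analysis.Analysis"
begin

datatype 'a hyperbolic = Hyp (hyp_re: 'a) (hyp_im: 'a)

text \<open>\<^term>\<open>Hyp a b\<close> is \<open>a + b j\<close> with \<open>j\<^sup>2 = 1\<close>.  Hyperbolic numbers proper are
  \<^typ>\<open>real hyperbolic\<close>; \<^typ>\<open>complex hyperbolic\<close> is the ring with complex coefficients.\<close>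

instantiation hyperbolic :: (comm_ring_1) comm_ring_1
begin

definition "0 = Hyp 0 0"
definition "1 = Hyp 1 0"
definition "x + y = Hyp (hyp_re x + hyp_re y) (hyp_im x + hyp_im y)"
definition "x - y = Hyp (hyp_re x - hyp_re y) (hyp_im x - hyp_im y)"
definition "- x = Hyp (- hyp_re x) (- hyp_im x)"
definition "x * y = Hyp (hyp_re x * hyp_re y + hyp_im x * hyp_im y)
                        (hyp_re x * hyp_im y + hyp_im x * hyp_re y)"

instance
  by standard
    (auto simp: zero_hyperbolic_def one_hyperbolic_def plus_hyperbolic_def
      minus_hyperbolic_def uminus_hyperbolic_def times_hyperbolic_def algebra_simps)

end

definition hyp_j :: "'a::comm_ring_1 hyperbolic" where
  "hyp_j = Hyp 0 1"

definition hyp_of :: "'a::comm_ring_1 \<Rightarrow> 'a hyperbolic" where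
  "hyp_of a = Hyp a 0"

lemma hyp_j_square: "hyp_j ^ 2 = 1"
  by (simp add: hyp_j_def power2_eq_square times_hyperbolic_def one_hyperbolic_def)

lemma Hyp_eq: "Hyp a b = hyp_of a + hyp_of b * hyp_j"
  by (simp add: hyp_of_def hyp_j_def times_hyperbolic_def plus_hyperbolic_def)

fun padovan :: "nat \<Rightarrow> nat" where
  "padovan 0 = 1"
| "padovan (Suc 0) = 1"
| "padovan (Suc (Suc 0)) = 1"
| "padovan (Suc (Suc (Suc n))) = padovan (Suc n) + padovan n"

fun perrin :: "nat \<Rightarrow> nat" where
  "perrin 0 = 3"
| "perrin (Suc 0) = 0"
| "perrin (Suc (Suc 0)) = 2"
| "perrin (Suc (Suc (Suc n))) = perrin (Suc n) + perrin n"

definition padovan_spinor :: "nat \<Rightarrow> real hyperbolic ^ 2" where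
  "padovan_spinor n = vector
     [of_nat (padovan n) + of_nat (padovan (n + 3)) * hyp_j,
      - of_nat (padovan (n + 1)) + of_nat (padovan (n + 2)) * hyp_j]"

definition perrin_spinor :: "nat \<Rightarrow> real hyperbolic ^ 2" where
  "perrin_spinor n = vector
     [of_nat (perrin n) + of_nat (perrin (n + 3)) * hyp_j,
      - of_nat (perrin (n + 1)) + of_nat (perrin (n + 2)) * hyp_j]"

definition complexify_spinor :: "real hyperbolic ^ 2 \<Rightarrow> complex hyperbolic ^ 2" where
  "complexify_spinor v = (\<chi> i. map_hyperbolic complex_of_real (v $ i))"

definition root_spinor :: "complex \<Rightarrow> complex hyperbolic ^ 2" where
  "root_spinor x = vector
     [1 + hyp_of (x ^ 3) * hyp_j, hyp_of x * (- 1 + hyp_of x * hyp_j)]"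

end

theory Submission
  imports Defs
begin

text \<open>Both number sequences satisfy the recurrence with characteristic polynomial
  \<open>x\<^sup>3 - x - 1\<close>, so a Binet formula need only be checked for \<open>n \<le> 2\<close>. For the Perrin numbers
  the initial values are the power sums of the roots, which follow from Vieta's relations. For the
  Padovan numbers, \<open>\<sigma>\<^sub>i\<close> is the \<open>i\<close>-th Lagrange basis polynomial of the roots evaluated at \<open>1\<close>, and
  interpolating \<open>1, x, x\<^sup>2\<close> at \<open>1\<close> gives \<open>1, 1, 1\<close>.\<close>

lemma lagrange_at_one:
  fixes a b c :: "'a::field"
  assumes "a \<noteq> b" "a \<noteq> c" "b \<noteq> c" "k \<le> 2"
  shows "(b - 1) * (c - 1) / ((a - b) * (a - c)) * a ^ k
       + (a - 1) * (c - 1) / ((b - a) * (b - c)) * b ^ k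
       + (a - 1) * (b - 1) / ((c - a) * (c - b)) * c ^ k = 1"
proof -
  define D where "D = (a - b) * (a - c) * (b - c)"
  have D: "D \<noteq> 0"
    using assms by (simp add: D_def)
  \<comment> \<open>Over the Vandermonde product \<open>D\<close>, each weight is missing one
    difference. Only the middle one gets a minus sign: \<open>b - a\<close> is reversed once, while
    the two reversals in the third cancel.\<close>
  have quot: "(b - 1) * (c - 1) / ((a - b) * (a - c)) = (b - 1) * (c - 1) * (b - c) / D"
    "(a - 1) * (c - 1) / ((b - a) * (b - c)) = - ((a - 1) * (c - 1) * (a - c)) / D"
    "(a - 1) * (b - 1) / ((c - a) * (c - b)) = (a - 1) * (b - 1) * (a - b) / D"
    by (subst frac_eq_eq, simp add: assms assms(1-3)[symmetric], fact D, simp only: D_def, algebra)+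
  have num: "(b - 1) * (c - 1) * (b - c) * a ^ k + - ((a - 1) * (c - 1) * (a - c)) * b ^ k
      + (a - 1) * (b - 1) * (a - b) * c ^ k = D"
  proof -
    from \<open>k \<le> 2\<close> consider "k = 0" | "k = 1" | "k = 2"
      by linarith
    then show ?thesis
      by cases (simp_all add: D_def algebra_simps power2_eq_square)
  qed
  show ?thesis
    unfolding quot times_divide_eq_left add_divide_distrib[symmetric] num using D by simp
qed

text \<open>Divided differences replace a factorization of the cubic: subtracting two root equations
  lets \<open>a - b\<close> or \<open>a - c\<close> be cancelled, and subtracting the two resulting
  quadratics leaves \<open>b - c\<close> times the sum of the roots.\<close>

lemma cubic_vieta:
  fixes a b c :: "'a::idom"
  assumes "a ^ 3 - a - 1 = 0" "b ^ 3 - b - 1 = 0" "c ^ 3 - c - 1 = 0"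
    and "a \<noteq> b" "a \<noteq> c" "b \<noteq> c"
  shows "a + b + c = 0" "a * b + a * c + b * c = - 1"
proof -
  have "(a - b) * (a\<^sup>2 + a * b + b\<^sup>2 - 1) = 0" "(a - c) * (a\<^sup>2 + a * c + c\<^sup>2 - 1) = 0"
    using assms(1-3) by algebra+
  then have q: "a\<^sup>2 + a * b + b\<^sup>2 - 1 = 0" "a\<^sup>2 + a * c + c\<^sup>2 - 1 = 0"
    using assms(4,5) by simp_all
  then have "(b - c) * (a + b + c) = 0"
    by algebra
  then show s: "a + b + c = 0"
    using \<open>b \<noteq> c\<close> by simp
  show "a * b + a * c + b * c = - 1"
    using s q by algebra
qed

lemma power_recurrence:
  fixes x :: "'a::comm_ring_1"
  assumes "x ^ 3 - x - 1 = 0"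
  shows "x ^ Suc (Suc (Suc n)) = x ^ Suc n + x ^ n"
proof -
  have "x ^ Suc (Suc (Suc n)) = x ^ 3 * x ^ n"
    by (simp add: power3_eq_cube mult.assoc)
  also have "x ^ 3 = x + 1"
    using assms by (simp add: algebra_simps)
  finally show ?thesis
    by (simp add: algebra_simps)
qed

lemma padovan_binet:
  fixes a b c :: "'a::field"
  assumes root: "a ^ 3 - a - 1 = 0" "b ^ 3 - b - 1 = 0" "c ^ 3 - c - 1 = 0"
    and dist: "a \<noteq> b" "a \<noteq> c" "b \<noteq> c"
  shows "of_nat (padovan n) = (b - 1) * (c - 1) / ((a - b) * (a - c)) * a ^ n
       + (a - 1) * (c - 1) / ((b - a) * (b - c)) * b ^ n
       + (a - 1) * (b - 1) / ((c - a) * (c - b)) * c ^ n"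
proof (induction n rule: padovan.induct)
  case 1
  show ?case using lagrange_at_one[OF dist, of 0] by simp
next
  case 2
  show ?case using lagrange_at_one[OF dist, of 1] by simp
next
  case 3
  show ?case using lagrange_at_one[OF dist, of 2] by (simp add: numeral_2_eq_2)
next
  case (4 n)
  show ?case
    unfolding padovan.simps of_nat_add 4 root[THEN power_recurrence]
    by (simp only: distrib_left distrib_right ac_simps)
qed

lemma perrin_binet:
  fixes a b c :: "'a::idom"
  assumes root: "a ^ 3 - a - 1 = 0" "b ^ 3 - b - 1 = 0" "c ^ 3 - c - 1 = 0"
    and dist: "a \<noteq> b" "a \<noteq> c" "b \<noteq> c"
  shows "of_nat (perrin n) = a ^ n + b ^ n + c ^ n"
proof (induction n rule: perrin.induct)
  case 1
  show ?case by simp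
next
  case 2
  show ?case using cubic_vieta(1)[OF assms] by simp
next
  case 3
  \<comment> \<open>Square of the sum minus twice the pairwise products: 0 - 2 * (-1).\<close>
  have "a\<^sup>2 + b\<^sup>2 + c\<^sup>2 = 2"
    using cubic_vieta[OF assms] by algebra
  then show ?case by (simp add: numeral_2_eq_2)
next
  case (4 n)
  show ?case
    unfolding perrin.simps of_nat_add 4 root[THEN power_recurrence]
    by (simp only: ac_simps)
qed

lemma of_nat_hyperbolic: "of_nat n = Hyp (of_nat n) 0"
  by (induction n) (simp_all add: zero_hyperbolic_def one_hyperbolic_def plus_hyperbolic_def)

lemmas hyperbolic_ops = of_nat_hyperbolic hyp_j_def hyp_of_def zero_hyperbolic_def
  one_hyperbolic_def plus_hyperbolic_def uminus_hyperbolic_def times_hyperbolic_def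

text \<open>Shifting the index by k multiplies the term of a root x by \<open>x ^ k\<close>; the
  shifts 0, 3, 1, 2 in the spinor produce exactly the entries of \<open>root_spinor x\<close>. The
  weights stay arbitrary so that both sequences are covered.\<close>

lemma complexify_spinor_binet:
  fixes f :: "nat \<Rightarrow> nat"
  assumes "\<And>n. of_nat (f n) = s * a ^ n + t * b ^ n + u * c ^ n"
  shows "complexify_spinor (vector
      [of_nat (f n) + of_nat (f (n + 3)) * hyp_j, - of_nat (f (n + 1)) + of_nat (f (n + 2)) * hyp_j])
    = hyp_of (s * a ^ n) *s root_spinor a + hyp_of (t * b ^ n) *s root_spinor b
      + hyp_of (u * c ^ n) *s root_spinor c"
  by (simp add: vec_eq_iff forall_2 complexify_spinor_def root_spinor_def vector_2
      hyperbolic_ops assms power_add algebra_simps power2_eq_square del: of_nat_add)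

theorem theorem14:
  fixes \<alpha> \<beta> \<gamma> \<sigma>1 \<sigma>2 \<sigma>3 :: complex and A B C :: "complex hyperbolic ^ 2" and n :: nat
  assumes roots: "{x :: complex. x ^ 3 - x - 1 = 0} = {\<alpha>, \<beta>, \<gamma>}"
    and alpha_real: "\<alpha> \<in> \<real>"
    and beta_im: "Im \<beta> > 0"
    and conj: "\<gamma> = cnj \<beta>"
    and sigma1: "\<sigma>1 = (\<beta> - 1) * (\<gamma> - 1) / ((\<alpha> - \<beta>) * (\<alpha> - \<gamma>))"
    and sigma2: "\<sigma>2 = (\<alpha> - 1) * (\<gamma> - 1) / ((\<beta> - \<alpha>) * (\<beta> - \<gamma>))"
    and sigma3: "\<sigma>3 = (\<alpha> - 1) * (\<beta> - 1) / ((\<gamma> - \<alpha>) * (\<gamma> - \<beta>))"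
    and A: "A = root_spinor \<alpha>" and B: "B = root_spinor \<beta>" and C: "C = root_spinor \<gamma>"
  shows "complexify_spinor (padovan_spinor n) =
           hyp_of (\<sigma>1 * \<alpha> ^ n) *s A + hyp_of (\<sigma>2 * \<beta> ^ n) *s B + hyp_of (\<sigma>3 * \<gamma> ^ n) *s C
       \<and> complexify_spinor (perrin_spinor n) =
           hyp_of (\<alpha> ^ n) *s A + hyp_of (\<beta> ^ n) *s B + hyp_of (\<gamma> ^ n) *s C"
proof -
  have root: "\<alpha> ^ 3 - \<alpha> - 1 = 0" "\<beta> ^ 3 - \<beta> - 1 = 0" "\<gamma> ^ 3 - \<gamma> - 1 = 0"
    using roots by blast+
  \<comment> \<open>The imaginary parts are zero, positive and negative, which separates the three
    roots.\<close>
  have "Im \<alpha> = 0" "Im \<gamma> < 0"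
    using alpha_real beta_im conj by (simp_all add: complex_is_Real_iff)
  then have dist: "\<alpha> \<noteq> \<beta>" "\<alpha> \<noteq> \<gamma>" "\<beta> \<noteq> \<gamma>"
    using beta_im by auto
  \<comment> \<open>Padovan takes the Lagrange weights, Perrin the weights 1.\<close>
  show ?thesis
    using complexify_spinor_binet[OF padovan_binet[OF root dist], of n]
      complexify_spinor_binet[of perrin 1 \<alpha> 1 \<beta> 1 \<gamma> n] perrin_binet[OF root dist]
    by (simp add: padovan_spinor_def perrin_spinor_def sigma1 sigma2 sigma3 A B C)
qed

end
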